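(* The system $$v_t=-(a_2x+a_1)u+\tfrac12u_x,\qquad v_x=u,$$ with $a_1\in\mathbb{R}$ and $a_2\neq0$, admits a nontrivial symmetry group with the following infinitesimal generators: $$W_1=e^{a_2t}\frac{\partial}{\partial x},\qquad W_2=u\frac{\partial}{\partial u}+v\frac{\partial}{\partial v},\qquad W_4=\frac{\partial}{\partial t},$$ $$W_3=\frac{1}{2a_2}e^{-a_2t}\frac{\partial}{\partial x}+\Big[\Big(x+\frac{a_1}{a_2}\Big)u+v\Big]e^{-a_2t}\frac{\partial}{\partial u}+\Big(\frac{a_1}{a_2}v+xv\Big)e^{-a_2t}\frac{\partial}{\partial v},$$ $$W_5=-(a_2x+a_1)e^{-2a_2t}\frac{\partial}{\partial x}+e^{-2a_2t}\frac{\partial}{\partial t}-2\Big[\big((a_2x+a_1)^2-a_2\big)u+2a_2(a_2x+a_1)v\Big]e^{-2a_2t}\frac{\partial}{\partial u}-2\Big[(a_2x+a_1)^2-a_2\Big]ve^{-2a_2t}\frac{\partial}{\partial v},$$ $$W_6=e^{2a_2t}\frac{\partial}{\partial t}+(a_2x+a_1)e^{2a_2t}\frac{\partial}{\partial x}-a_2ue^{2a_2t}\frac{\partial}{\partial u},$$ and an infinite number of generators of the form $W_\beta=\beta_x(x,t)\frac{\partial}{\partial u}+\beta(x,t)\frac{\partial}{\partial v}$, where $\beta(x,t)$ satisfies the equation $\beta_t=-(a_2x+a_1)\beta_x+\frac12\beta_{xx}$.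
   Context: Here $a_1,a_2$ are real numbers, the independent variables are $(x,t)$ and the dependent variables are $u(x,t)$, $v(x,t)$; subscripts denote partial derivatives, and all functions are smooth. Put $\Delta_1=v_t+(a_2x+a_1)u-\frac12u_x$ and $\Delta_2=v_x-u$, regarded as functions on the jet space. The symmetries considered are point symmetries. A vector field $W=\xi\frac{\partial}{\partial x}+\tau\frac{\partial}{\partial t}+\eta\frac{\partial}{\partial u}+\phi\frac{\partial}{\partial v}$, with $\xi,\tau,\eta,\phi$ functions of $(x,t,u,v)$, is an infinitesimal generator of point symmetries of the system if its prolongation to the jet space annihilates $\Delta_1$ and $\Delta_2$ whenever $\Delta_1=\Delta_2=0$. Since $\Delta_1,\Delta_2$ involve only first-order derivatives, only the following part of the prolongation matters: $$W+\eta^x\frac{\partial}{\partial u_x}+\eta^t\frac{\partial}{\partial u_t}+\phi^x\frac{\partial}{\partial v_x}+\phi^t\frac{\partial}{\partial v_t},$$ where, with $D_x,D_t$ the total derivatives, $\eta^x=D_x\eta-u_xD_x\xi-u_tD_x\tau$, $\eta^t=D_t\eta-u_xD_t\xi-u_tD_t\tau$, $\phi^x=D_x\phi-v_xD_x\xi-v_tD_x\tau$, $\phi^t=D_t\phi-v_xD_t\xi-v_tD_t\tau$.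
   Formalization: The v-component of W_5 is corrected to -2[(a_2x+a_1)^2 - a_2/2] v e^{-2a_2t}; with the printed a_2 in place of a_2/2, W_5 is not a symmetry generator for any a_2≠0, since invariance of v_x=u fails. *)

theory Defs
  imports "HOL-Analysis.Analysis"
begin

text \<open>
  A function on a Euclidean space is \<open>C\<close>-infinity iff all of its iterated directional
  derivatives exist and are differentiable (hence continuous).
\<close>

primrec k_times_diff :: "nat \<Rightarrow> ('a::euclidean_space \<Rightarrow> real) \<Rightarrow> bool" where
  "k_times_diff 0 f \<longleftrightarrow> continuous_on UNIV f"
| "k_times_diff (Suc k) f \<longleftrightarrow>
     f differentiable_on UNIV \<and> (\<forall>h. k_times_diff k (\<lambda>p. frechet_derivative f (at p) h))"

definition smooth :: "('a::euclidean_space \<Rightarrow> real) \<Rightarrow> bool" where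
  "smooth f \<longleftrightarrow> (\<forall>k. k_times_diff k f)"

text \<open>
  Points of the base space are \<open>(x, t, u, v)\<close>; points of the first-order jet space are
  \<open>(x, t, u, v, u\<^sub>x, u\<^sub>t, v\<^sub>x, v\<^sub>t)\<close>.
\<close>

type_synonym base = "real \<times> real \<times> real \<times> real"
type_synonym jet = "real \<times> real \<times> real \<times> real \<times> real \<times> real \<times> real \<times> real"

text \<open>The vector field \<open>\<xi> \<partial>\<^sub>x + \<tau> \<partial>\<^sub>t + \<eta> \<partial>\<^sub>u + \<phi> \<partial>\<^sub>v\<close>.\<close>

record vfield =
  xi :: "base \<Rightarrow> real"
  tau :: "base \<Rightarrow> real"
  eta :: "base \<Rightarrow> real"
  phi :: "base \<Rightarrow> real"

definition zero_vfield :: vfield where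
  "zero_vfield = \<lparr>xi = (\<lambda>_. 0), tau = (\<lambda>_. 0), eta = (\<lambda>_. 0), phi = (\<lambda>_. 0)\<rparr>"

text \<open>
  The total derivatives \<open>f\<^sub>x + u\<^sub>x f\<^sub>u + v\<^sub>x f\<^sub>v\<close> and \<open>f\<^sub>t + u\<^sub>t f\<^sub>u + v\<^sub>t f\<^sub>v\<close>, written as derivatives
  of \<open>f\<close> in the directions \<open>(1, 0, u\<^sub>x, v\<^sub>x)\<close> and \<open>(0, 1, u\<^sub>t, v\<^sub>t)\<close>.
\<close>

definition total_x :: "(base \<Rightarrow> real) \<Rightarrow> jet \<Rightarrow> real" where
  "total_x f = (\<lambda>(x, t, u, v, ux, ut, vx, vt).
     frechet_derivative f (at (x, t, u, v)) (1, 0, ux, vx))"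

definition total_t :: "(base \<Rightarrow> real) \<Rightarrow> jet \<Rightarrow> real" where
  "total_t f = (\<lambda>(x, t, u, v, ux, ut, vx, vt).
     frechet_derivative f (at (x, t, u, v)) (0, 1, ut, vt))"

text \<open>
  The first prolongation of \<open>W\<close>: its component vector at a point of the jet space, and its
  action as a derivation on a function \<open>F\<close> on the jet space.
\<close>

definition prolongation :: "vfield \<Rightarrow> jet \<Rightarrow> jet" where
  "prolongation W = (\<lambda>(x, t, u, v, ux, ut, vx, vt).
     let p = (x, t, u, v); j = (x, t, u, v, ux, ut, vx, vt) in
     (xi W p, tau W p, eta W p, phi W p,
      total_x (eta W) j - ux * total_x (xi W) j - ut * total_x (tau W) j,
      total_t (eta W) j - ux * total_t (xi W) j - ut * total_t (tau W) j,
      total_x (phi W) j - vx * total_x (xi W) j - vt * total_x (tau W) j,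
      total_t (phi W) j - vx * total_t (xi W) j - vt * total_t (tau W) j))"

definition pr_apply :: "vfield \<Rightarrow> (jet \<Rightarrow> real) \<Rightarrow> jet \<Rightarrow> real" where
  "pr_apply W F j = frechet_derivative F (at j) (prolongation W j)"

definition Delta1 :: "real \<Rightarrow> real \<Rightarrow> jet \<Rightarrow> real" where
  "Delta1 a1 a2 = (\<lambda>(x, t, u, v, ux, ut, vx, vt). vt + (a2 * x + a1) * u - 1/2 * ux)"

definition Delta2 :: "jet \<Rightarrow> real" where
  "Delta2 = (\<lambda>(x, t, u, v, ux, ut, vx, vt). vx - u)"

definition is_symmetry_generator :: "real \<Rightarrow> real \<Rightarrow> vfield \<Rightarrow> bool" where
  "is_symmetry_generator a1 a2 W \<longleftrightarrow>
     smooth (xi W) \<and> smooth (tau W) \<and> smooth (eta W) \<and> smooth (phi W) \<and>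
     (\<forall>j. Delta1 a1 a2 j = 0 \<and> Delta2 j = 0 \<longrightarrow>
        pr_apply W (Delta1 a1 a2) j = 0 \<and> pr_apply W Delta2 j = 0)"

definition W1 :: "real \<Rightarrow> vfield" where
  "W1 a2 = \<lparr>
     xi = (\<lambda>(x, t, u, v). exp (a2 * t)),
     tau = (\<lambda>_. 0),
     eta = (\<lambda>_. 0),
     phi = (\<lambda>_. 0)\<rparr>"

definition W2 :: vfield where
  "W2 = \<lparr>
     xi = (\<lambda>_. 0),
     tau = (\<lambda>_. 0),
     eta = (\<lambda>(x, t, u, v). u),
     phi = (\<lambda>(x, t, u, v). v)\<rparr>"

definition W3 :: "real \<Rightarrow> real \<Rightarrow> vfield" where
  "W3 a1 a2 = \<lparr>
     xi = (\<lambda>(x, t, u, v). 1 / (2 * a2) * exp (- a2 * t)),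
     tau = (\<lambda>_. 0),
     eta = (\<lambda>(x, t, u, v). ((x + a1 / a2) * u + v) * exp (- a2 * t)),
     phi = (\<lambda>(x, t, u, v). (a1 / a2 * v + x * v) * exp (- a2 * t))\<rparr>"

definition W4 :: vfield where
  "W4 = \<lparr>
     xi = (\<lambda>_. 0),
     tau = (\<lambda>_. 1),
     eta = (\<lambda>_. 0),
     phi = (\<lambda>_. 0)\<rparr>"

text \<open>
  In the literature the last component of \<open>W5\<close> is printed as
  \<open>- 2 * ((a2 * x + a1)\<^sup>2 - a2) * v * exp (- 2 * a2 * t)\<close>, with \<open>a2\<close> in place of \<open>a2 / 2\<close>.
  This is a misprint: with it the field is not a symmetry generator for any \<open>a2 \<noteq> 0\<close>, see
  \<open>printed_W5_not_symmetry_generator\<close> below.  The other three components, which are as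
  printed, force the coefficient used here, because invariance of \<open>v\<^sub>x = u\<close> requires
  \<open>\<eta> = \<phi>\<^sub>x + u \<phi>\<^sub>v - u \<xi>\<^sub>x\<close> on solutions.
\<close>

definition W5 :: "real \<Rightarrow> real \<Rightarrow> vfield" where
  "W5 a1 a2 = \<lparr>
     xi = (\<lambda>(x, t, u, v). - (a2 * x + a1) * exp (- 2 * a2 * t)),
     tau = (\<lambda>(x, t, u, v). exp (- 2 * a2 * t)),
     eta = (\<lambda>(x, t, u, v).
       - 2 * (((a2 * x + a1)\<^sup>2 - a2) * u + 2 * a2 * (a2 * x + a1) * v) * exp (- 2 * a2 * t)),
     phi = (\<lambda>(x, t, u, v). - 2 * ((a2 * x + a1)\<^sup>2 - a2 / 2) * v * exp (- 2 * a2 * t))\<rparr>"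

definition W6 :: "real \<Rightarrow> real \<Rightarrow> vfield" where
  "W6 a1 a2 = \<lparr>
     xi = (\<lambda>(x, t, u, v). (a2 * x + a1) * exp (2 * a2 * t)),
     tau = (\<lambda>(x, t, u, v). exp (2 * a2 * t)),
     eta = (\<lambda>(x, t, u, v). - a2 * u * exp (2 * a2 * t)),
     phi = (\<lambda>_. 0)\<rparr>"

text \<open>Partial derivatives of a function of \<open>(x, t)\<close>.\<close>

definition partial_x :: "(real \<times> real \<Rightarrow> real) \<Rightarrow> real \<times> real \<Rightarrow> real" where
  "partial_x f p = frechet_derivative f (at p) (1, 0)"

definition partial_t :: "(real \<times> real \<Rightarrow> real) \<Rightarrow> real \<times> real \<Rightarrow> real" where
  "partial_t f p = frechet_derivative f (at p) (0, 1)"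

definition beta_solution :: "real \<Rightarrow> real \<Rightarrow> (real \<times> real \<Rightarrow> real) \<Rightarrow> bool" where
  "beta_solution a1 a2 \<beta> \<longleftrightarrow> smooth \<beta> \<and>
     (\<forall>x t. partial_t \<beta> (x, t) =
        - (a2 * x + a1) * partial_x \<beta> (x, t) + 1/2 * partial_x (partial_x \<beta>) (x, t))"

definition W_beta :: "(real \<times> real \<Rightarrow> real) \<Rightarrow> vfield" where
  "W_beta \<beta> = \<lparr>
     xi = (\<lambda>_. 0),
     tau = (\<lambda>_. 0),
     eta = (\<lambda>(x, t, u, v). partial_x \<beta> (x, t)),
     phi = (\<lambda>(x, t, u, v). \<beta> (x, t))\<rparr>"

lemma printed_W5_not_symmetry_generator:
  assumes "a2 \<noteq> 0"
  shows "\<not> is_symmetry_generator a1 a2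
    (W5 a1 a2\<lparr>phi := \<lambda>(x, t, u, v). - 2 * ((a2 * x + a1)\<^sup>2 - a2) * v * exp (- 2 * a2 * t)\<rparr>)"
    (is "\<not> is_symmetry_generator a1 a2 ?W")
proof
  assume sym: "is_symmetry_generator a1 a2 ?W"
  define j :: jet where "j = (0, 0, 1, 0, 0, 0, 1, - a1)"
  have "Delta1 a1 a2 j = 0" "Delta2 j = 0"
    by (simp_all add: j_def Delta1_def Delta2_def)
  with sym have *: "pr_apply ?W Delta2 j = 0"
    unfolding is_symmetry_generator_def by blast
  have xi: "((\<lambda>(x, t, u, v). - (a2 * x + a1) * exp (- 2 * a2 * t)) has_derivative
      (\<lambda>(hx, ht, hu, hv). - a2 * hx + 2 * a2 * a1 * ht)) (at (0, 0, 1, 0) :: base filter)"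
    unfolding case_prod_beta
    by (rule has_derivative_eq_rhs, (rule derivative_intros)+)
      (auto simp: fun_eq_iff algebra_simps)
  have tau: "((\<lambda>(x, t, u, v). exp (- 2 * a2 * t)) has_derivative
      (\<lambda>(hx, ht, hu, hv). - 2 * a2 * ht)) (at (0, 0, 1, 0) :: base filter)"
    unfolding case_prod_beta
    by (rule has_derivative_eq_rhs, (rule derivative_intros)+)
      (auto simp: fun_eq_iff algebra_simps)
  have phi: "((\<lambda>(x, t, u, v). - 2 * ((a2 * x + a1)\<^sup>2 - a2) * v * exp (- 2 * a2 * t)) has_derivative
      (\<lambda>(hx, ht, hu, hv). - 2 * (a1\<^sup>2 - a2) * hv)) (at (0, 0, 1, 0) :: base filter)"
    unfolding case_prod_beta
    by (rule has_derivative_eq_rhs, (rule derivative_intros)+)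
      (auto simp: fun_eq_iff algebra_simps)
  have Delta2: "(Delta2 has_derivative (\<lambda>(hx, ht, hu, hv, hux, hut, hvx, hvt). hvx - hu)) (at j)"
    unfolding Delta2_def case_prod_beta
    by (rule has_derivative_eq_rhs, (rule derivative_intros)+) auto
  have eta_j: "fst (snd (snd (prolongation ?W j))) = - 2 * (a1\<^sup>2 - a2)"
    by (simp add: prolongation_def j_def W5_def Let_def)
  have phi_x_j: "fst (snd (snd (snd (snd (snd (snd (prolongation ?W j))))))) =
      - 2 * (a1\<^sup>2 - a2) + a2"
    unfolding prolongation_def j_def W5_def Let_def total_x_def vfield.simps prod.case
      frechet_derivative_at[OF xi, symmetric] frechet_derivative_at[OF tau, symmetric]
      frechet_derivative_at[OF phi, symmetric]
    by simp
  have "pr_apply ?W Delta2 j =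
      fst (snd (snd (snd (snd (snd (snd (prolongation ?W j))))))) -
      fst (snd (snd (prolongation ?W j)))"
    unfolding pr_apply_def frechet_derivative_at[OF Delta2, symmetric]
    by (simp only: case_prod_beta)
  also have "\<dots> = a2"
    unfolding eta_j phi_x_j by simp
  finally show False
    using * \<open>a2 \<noteq> 0\<close> by linarith
qed

end

theory Submission
  imports Defs
begin

text \<open>
  Once the derivatives of its four components are known, the first prolongation of a field is
  polynomial in the first-order jet coordinates.  On the solution manifold
  \<open>v\<^sub>x = u\<close>, \<open>v\<^sub>t = u\<^sub>x / 2 - (a\<^sub>2 x + a\<^sub>1) u\<close> the coordinates \<open>x, t, u, v, u\<^sub>x, u\<^sub>t\<close> are free, so
  invariance of the system means that two expressions in them vanish identically: these are the
  determining equations, and \<open>is_symmetry_generatorI\<close> reduces the definition to them.  For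
  \<open>W1\<close>, \<dots>, \<open>W6\<close> they are polynomial identities in these coordinates, multiplied by an exponential in \<open>t\<close>.  For
  \<open>W_beta \<beta>\<close> the first reads \<open>\<beta>\<^sub>x = \<beta>\<^sub>x\<close> and the second is the linear equation assumed of \<open>\<beta>\<close>:
  eliminating \<open>u = v\<^sub>x\<close>, the system is that very equation for \<open>v\<close>, and adding a solution of a linear
  homogeneous equation is a symmetry.  Constants are solutions, so this family is infinite.

  The remaining ingredient is smoothness of the components, which follows from the closure of
  the smooth functions under the operations used to build them: sums, products, the exponential,
  composition with linear maps, and directional derivatives.
\<close>

section \<open>Closure properties of smooth functions\<close>

lemma k_times_diff_SucI:
  assumes "\<And>p. (f has_derivative f' p) (at p)" and "\<And>h. k_times_diff k (\<lambda>p. f' p h)"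
  shows "k_times_diff (Suc k) f"
proof -
  have "frechet_derivative f (at p) = f' p" for p
    using frechet_derivative_at[OF assms(1)] by simp
  moreover have "f differentiable_on UNIV"
    using assms(1) by (auto simp: differentiable_on_def differentiable_def)
  ultimately show ?thesis using assms(2) by simp
qed

lemma k_times_diff_Suc_has_derivative:
  assumes "k_times_diff (Suc k) f"
  shows "(f has_derivative frechet_derivative f (at p)) (at p)"
  using assms by (simp add: differentiable_on_def frechet_derivative_works)

text \<open>
  The product rule leaves one factor undifferentiated, so an induction on the order has to be able
  to lower it.
\<close>

lemma k_times_diff_SucD: "k_times_diff (Suc k) f \<Longrightarrow> k_times_diff k f"
proof (induction k arbitrary: f)
  case 0
  then show ?case by (simp add: differentiable_imp_continuous_on)
next
  case (Suc k)
  have "k_times_diff (Suc k) (\<lambda>p. frechet_derivative f (at p) h)" for h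
    using Suc.prems by (subst (asm) k_times_diff.simps(2)) blast
  then have "k_times_diff k (\<lambda>p. frechet_derivative f (at p) h)" for h
    by (rule Suc.IH)
  then show ?case
    using Suc.prems by simp
qed

lemma smooth_has_derivative:
  assumes "smooth f"
  shows "(f has_derivative frechet_derivative f (at p)) (at p)"
  using assms k_times_diff_Suc_has_derivative unfolding smooth_def by blast

lemma smooth_frechet_derivative:
  "smooth f \<Longrightarrow> smooth (\<lambda>p. frechet_derivative f (at p) h)"
  unfolding smooth_def using k_times_diff.simps(2) by blast

named_theorems smooth_intros

lemma k_times_diff_const: "k_times_diff k (\<lambda>_. c)"
  by (induction k arbitrary: c) (auto intro: k_times_diff_SucI has_derivative_const)

lemma smooth_const [smooth_intros]: "smooth (\<lambda>_. c)"
  by (simp add: smooth_def k_times_diff_const)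

lemma smooth_bounded_linear:
  assumes "bounded_linear f"
  shows "smooth f"
  unfolding smooth_def
proof
  fix k
  show "k_times_diff k f"
  proof (cases k)
    case 0
    then show ?thesis using assms by (simp add: linear_continuous_on)
  next
    case (Suc l)
    have "k_times_diff (Suc l) f"
      by (rule k_times_diff_SucI[OF bounded_linear_imp_has_derivative[OF assms] k_times_diff_const])
    then show ?thesis by (simp only: Suc)
  qed
qed

lemma k_times_diff_add:
  "k_times_diff k f \<Longrightarrow> k_times_diff k g \<Longrightarrow> k_times_diff k (\<lambda>p. f p + g p)"
proof (induction k arbitrary: f g)
  case 0
  then show ?case by (simp add: continuous_on_add)
next
  case (Suc k)
  show ?case
    by (rule k_times_diff_SucI, rule has_derivative_add;
        (rule Suc.prems[THEN k_times_diff_Suc_has_derivative])?)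
      (use Suc in auto)
qed

lemma smooth_add [smooth_intros]: "smooth f \<Longrightarrow> smooth g \<Longrightarrow> smooth (\<lambda>p. f p + g p)"
  by (simp add: smooth_def k_times_diff_add)

lemma k_times_diff_mult:
  "k_times_diff k f \<Longrightarrow> k_times_diff k g \<Longrightarrow> k_times_diff k (\<lambda>p. f p * g p)"
proof (induction k arbitrary: f g)
  case 0
  then show ?case by (simp add: continuous_on_mult)
next
  case (Suc k)
  have "k_times_diff k (\<lambda>p. f p * frechet_derivative g (at p) h + frechet_derivative f (at p) h * g p)"
    for h
    using Suc by (intro k_times_diff_add Suc.IH k_times_diff_SucD[of k f] k_times_diff_SucD[of k g]) auto
  then show ?case
    using has_derivative_mult[OF Suc.prems[THEN k_times_diff_Suc_has_derivative]]
    by (rule k_times_diff_SucI[rotated])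
qed

lemma smooth_mult [smooth_intros]: "smooth f \<Longrightarrow> smooth g \<Longrightarrow> smooth (\<lambda>p. f p * g p)"
  by (simp add: smooth_def k_times_diff_mult)

lemma smooth_minus [smooth_intros]: "smooth f \<Longrightarrow> smooth (\<lambda>p. - f p)"
  using smooth_mult[OF smooth_const[of "-1"]] by simp

lemma smooth_diff [smooth_intros]: "smooth f \<Longrightarrow> smooth g \<Longrightarrow> smooth (\<lambda>p. f p - g p)"
  using smooth_add[OF _ smooth_minus, of f g] by simp

lemma smooth_power2 [smooth_intros]: "smooth f \<Longrightarrow> smooth (\<lambda>p. (f p)\<^sup>2)"
  by (simp add: power2_eq_square smooth_mult)

text \<open>
  The derivative of \<open>exp \<circ> f\<close> is the function itself times that of \<open>f\<close>, so one order of
  differentiability is gained at a time from the product rule.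
\<close>

lemma smooth_exp [smooth_intros]:
  assumes "smooth f"
  shows "smooth (\<lambda>p. exp (f p))"
  unfolding smooth_def
proof
  fix k
  show "k_times_diff k (\<lambda>p. exp (f p))"
  proof (induction k)
    case 0
    have "k_times_diff 0 f" using assms by (simp only: smooth_def)
    then show ?case by (simp add: continuous_on_exp)
  next
    case (Suc k)
    have "k_times_diff k (\<lambda>p. frechet_derivative f (at p) h)" for h
      using smooth_frechet_derivative[OF assms] by (simp add: smooth_def)
    then have "k_times_diff k (\<lambda>p. exp (f p) * frechet_derivative f (at p) h)" for h
      using Suc.IH by (intro k_times_diff_mult)
    then show ?case
      using has_derivative_exp[OF smooth_has_derivative[OF assms]]
      by (intro k_times_diff_SucI[where f' = "\<lambda>p h. exp (f p) * frechet_derivative f (at p) h"])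
        (auto simp: mult.commute)
  qed
qed

text \<open>
  The derivative of \<open>f \<circ> L\<close> in direction \<open>h\<close> is again a composition with \<open>L\<close>, namely of the
  derivative of \<open>f\<close> in the fixed direction \<open>L h\<close>; hence the induction closes without a general
  chain rule of higher order.
\<close>

lemma k_times_diff_compose_linear:
  assumes "bounded_linear L"
  shows "k_times_diff k f \<Longrightarrow> k_times_diff k (\<lambda>p. f (L p))"
proof (induction k arbitrary: f)
  case 0
  then show ?case
    by (auto intro: continuous_on_compose2 linear_continuous_on[OF assms])
next
  case (Suc k)
  have "((\<lambda>p. f (L p)) has_derivative (\<lambda>h. frechet_derivative f (at (L p)) (L h))) (at p)" for p
    using has_derivative_compose[OF bounded_linear_imp_has_derivative[OF assms]
        k_times_diff_Suc_has_derivative[OF Suc.prems]] .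
  moreover have "k_times_diff k (\<lambda>p. frechet_derivative f (at (L p)) (L h))" for h
    using Suc.IH[of "\<lambda>q. frechet_derivative f (at q) (L h)"] Suc.prems by simp
  ultimately show ?case by (rule k_times_diff_SucI)
qed

lemma smooth_compose_linear:
  "bounded_linear L \<Longrightarrow> smooth f \<Longrightarrow> smooth (\<lambda>p. f (L p))"
  by (simp add: smooth_def k_times_diff_compose_linear)

lemma smooth_coordinates [smooth_intros]:
  "smooth (\<lambda>p::base. fst p)" "smooth (\<lambda>p::base. fst (snd p))"
  "smooth (\<lambda>p::base. fst (snd (snd p)))" "smooth (\<lambda>p::base. snd (snd (snd p)))"
  by (intro smooth_bounded_linear bounded_linear_intros)+

section \<open>The determining equations\<close>

text \<open>
  Both defining functions are affine in the first-order coordinates, so the prolonged field acts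
  on them by substituting its components.  On the solution manifold \<open>vx\<close> and \<open>vt\<close> are functions
  of the other coordinates; inserting them into the directions \<open>(1, 0, ux, vx)\<close> and
  \<open>(0, 1, ut, vt)\<close> of the total derivatives gives the equations below in free variables.
\<close>

lemma is_symmetry_generatorI:
  assumes smooth: "smooth (xi W)" "smooth (tau W)" "smooth (eta W)" "smooth (phi W)"
    and xi: "\<And>p. (xi W has_derivative Dxi p) (at p)"
    and tau: "\<And>p. (tau W has_derivative Dtau p) (at p)"
    and eta: "\<And>p. (eta W has_derivative Deta p) (at p)"
    and phi: "\<And>p. (phi W has_derivative Dphi p) (at p)"
    and det1: "\<And>x t u v ux ut p X T vt. p = (x, t, u, v) \<Longrightarrow> vt = 1/2 * ux - (a2 * x + a1) * u \<Longrightarrow>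
      X = (1, 0, ux, u) \<Longrightarrow> T = (0, 1, ut, vt) \<Longrightarrow>
      Dphi p T - u * Dxi p T - vt * Dtau p T + a2 * xi W p * u + (a2 * x + a1) * eta W p
        - 1/2 * (Deta p X - ux * Dxi p X - ut * Dtau p X) = 0"
    and det2: "\<And>x t u v ux ut p X vt. p = (x, t, u, v) \<Longrightarrow> vt = 1/2 * ux - (a2 * x + a1) * u \<Longrightarrow>
      X = (1, 0, ux, u) \<Longrightarrow>
      Dphi p X - u * Dxi p X - vt * Dtau p X - eta W p = 0"
  shows "is_symmetry_generator a1 a2 W"
proof -
  have "pr_apply W (Delta1 a1 a2) j = 0 \<and> pr_apply W Delta2 j = 0"
    if "Delta1 a1 a2 j = 0" "Delta2 j = 0" for j
  proof -
    obtain x t u v ux ut vx vt where j: "j = (x, t, u, v, ux, ut, vx, vt)"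
      by (metis prod.exhaust)
    have vx: "vx = u" and vt: "vt = 1/2 * ux - (a2 * x + a1) * u"
      using that by (simp_all add: j Delta1_def Delta2_def)
    have D1: "(Delta1 a1 a2 has_derivative (\<lambda>(hx, ht, hu, hv, hux, hut, hvx, hvt).
        hvt + a2 * hx * u + (a2 * x + a1) * hu - 1/2 * hux)) (at j)"
      unfolding Delta1_def case_prod_beta j
      by (rule has_derivative_eq_rhs, (rule derivative_intros)+) (auto simp: fun_eq_iff algebra_simps)
    have D2: "(Delta2 has_derivative (\<lambda>(hx, ht, hu, hv, hux, hut, hvx, hvt). hvx - hu)) (at j)"
      unfolding Delta2_def case_prod_beta
      by (rule has_derivative_eq_rhs, (rule derivative_intros)+) auto
    note frechet = frechet_derivative_at[OF xi, symmetric] frechet_derivative_at[OF tau, symmetric]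
      frechet_derivative_at[OF eta, symmetric] frechet_derivative_at[OF phi, symmetric]
    show ?thesis
      unfolding pr_apply_def frechet_derivative_at[OF D1, symmetric]
        frechet_derivative_at[OF D2, symmetric]
      unfolding prolongation_def j Let_def total_x_def total_t_def prod.case frechet
      using det1[OF refl vt refl refl, of t v ut] det2[OF refl vt refl, of t v] by (simp add: vx)
  qed
  with smooth show ?thesis unfolding is_symmetry_generator_def by blast
qed

section \<open>The six individual generators\<close>

lemma is_symmetry_generator_W1: "is_symmetry_generator a1 a2 (W1 a2)"
proof (rule is_symmetry_generatorI)
  show "smooth (xi (W1 a2))" "smooth (tau (W1 a2))"
    "smooth (eta (W1 a2))" "smooth (phi (W1 a2))"
    unfolding W1_def vfield.simps case_prod_beta by (intro smooth_intros)+
  show "(xi (W1 a2) has_derivative (\<lambda>h. a2 * exp (a2 * fst (snd p)) * fst (snd h))) (at p)" for p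
    unfolding W1_def vfield.simps case_prod_beta
    by (rule has_derivative_eq_rhs, (rule derivative_intros)+) (auto simp: fun_eq_iff)
qed (auto simp: W1_def intro!: smooth_intros has_derivative_const)

lemma is_symmetry_generator_W2: "is_symmetry_generator a1 a2 W2"
proof (rule is_symmetry_generatorI)
  show "smooth (xi W2)" "smooth (tau W2)"
    "smooth (eta W2)" "smooth (phi W2)"
    unfolding W2_def vfield.simps case_prod_beta by (intro smooth_intros)+
  show "(eta W2 has_derivative (\<lambda>h. fst (snd (snd h)))) (at p)" for p
    unfolding W2_def vfield.simps case_prod_beta by (intro derivative_intros)
  show "(phi W2 has_derivative (\<lambda>h. snd (snd (snd h)))) (at p)" for p
    unfolding W2_def vfield.simps case_prod_beta by (intro derivative_intros)
qed (auto simp: W2_def intro!: smooth_intros has_derivative_const)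

lemma is_symmetry_generator_W3:
  assumes "a2 \<noteq> 0"
  shows "is_symmetry_generator a1 a2 (W3 a1 a2)"
proof -
  \<comment> \<open>With \<open>a\<^sub>2 x + a\<^sub>1 = a\<^sub>2 (x + c)\<close> the determining equations contain no quotient of parameters.\<close>
  define c where "c = a1 / a2"
  have a1: "a1 = a2 * c" using assms by (simp add: c_def)
  show ?thesis
  proof (rule is_symmetry_generatorI)
    show "smooth (xi (W3 a1 a2))" "smooth (tau (W3 a1 a2))"
      "smooth (eta (W3 a1 a2))" "smooth (phi (W3 a1 a2))"
      unfolding W3_def vfield.simps case_prod_beta by (intro smooth_intros)+
    show "(xi (W3 a1 a2) has_derivative (\<lambda>h. - 1/2 * exp (- a2 * fst (snd p)) * fst (snd h))) (at p)" for p
      unfolding W3_def vfield.simps case_prod_beta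
      by (rule has_derivative_eq_rhs, (rule derivative_intros)+) (use assms in \<open>auto simp: fun_eq_iff\<close>)
    show "(eta (W3 a1 a2) has_derivative (\<lambda>h. case p of (x, t, u, v) \<Rightarrow> case h of (hx, ht, hu, hv) \<Rightarrow>
        exp (- a2 * t) * (u * hx - a2 * ((x + a1 / a2) * u + v) * ht + (x + a1 / a2) * hu + hv))) (at p)" for p
      unfolding W3_def vfield.simps case_prod_beta
      by (rule has_derivative_eq_rhs, (rule derivative_intros)+) (auto simp: fun_eq_iff algebra_simps)
    show "(phi (W3 a1 a2) has_derivative (\<lambda>h. case p of (x, t, u, v) \<Rightarrow> case h of (hx, ht, hu, hv) \<Rightarrow>
        exp (- a2 * t) * (v * hx - a2 * (x + a1 / a2) * v * ht + (x + a1 / a2) * hv))) (at p)" for p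
      unfolding W3_def vfield.simps case_prod_beta
      by (rule has_derivative_eq_rhs, (rule derivative_intros)+) (auto simp: fun_eq_iff algebra_simps)
  qed (use assms in \<open>auto simp: W3_def a1 algebra_simps add_divide_distrib intro!: has_derivative_const\<close>)
qed

lemma is_symmetry_generator_W4: "is_symmetry_generator a1 a2 W4"
  by (rule is_symmetry_generatorI)
    (auto simp: W4_def intro!: smooth_intros has_derivative_const)

lemma is_symmetry_generator_W5: "is_symmetry_generator a1 a2 (W5 a1 a2)"
proof (rule is_symmetry_generatorI)
  show "smooth (xi (W5 a1 a2))" "smooth (tau (W5 a1 a2))"
    "smooth (eta (W5 a1 a2))" "smooth (phi (W5 a1 a2))"
    unfolding W5_def vfield.simps case_prod_beta by (intro smooth_intros)+
  show "(xi (W5 a1 a2) has_derivative (\<lambda>h. case p of (x, t, u, v) \<Rightarrow> case h of (hx, ht, hu, hv) \<Rightarrow>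
      exp (- 2 * a2 * t) * (- a2 * hx + 2 * a2 * (a2 * x + a1) * ht))) (at p)" for p
    unfolding W5_def vfield.simps case_prod_beta
    by (rule has_derivative_eq_rhs, (rule derivative_intros)+) (auto simp: fun_eq_iff algebra_simps)
  show "(tau (W5 a1 a2) has_derivative (\<lambda>h. case p of (x, t, u, v) \<Rightarrow> case h of (hx, ht, hu, hv) \<Rightarrow>
      exp (- 2 * a2 * t) * (- 2 * a2 * ht))) (at p)" for p
    unfolding W5_def vfield.simps case_prod_beta
    by (rule has_derivative_eq_rhs, (rule derivative_intros)+) (auto simp: fun_eq_iff algebra_simps)
  show "(eta (W5 a1 a2) has_derivative (\<lambda>h. case p of (x, t, u, v) \<Rightarrow> case h of (hx, ht, hu, hv) \<Rightarrow>
      - 2 * exp (- 2 * a2 * t) * ((2 * a2 * (a2 * x + a1) * u + 2 * a2\<^sup>2 * v) * hx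
        - 2 * a2 * (((a2 * x + a1)\<^sup>2 - a2) * u + 2 * a2 * (a2 * x + a1) * v) * ht
        + ((a2 * x + a1)\<^sup>2 - a2) * hu + 2 * a2 * (a2 * x + a1) * hv))) (at p)" for p
    unfolding W5_def vfield.simps case_prod_beta
    by (rule has_derivative_eq_rhs, (rule derivative_intros)+)
      (auto simp: fun_eq_iff algebra_simps power2_eq_square)
  show "(phi (W5 a1 a2) has_derivative (\<lambda>h. case p of (x, t, u, v) \<Rightarrow> case h of (hx, ht, hu, hv) \<Rightarrow>
      - 2 * exp (- 2 * a2 * t) * (2 * a2 * (a2 * x + a1) * v * hx
        - 2 * a2 * ((a2 * x + a1)\<^sup>2 - a2 / 2) * v * ht + ((a2 * x + a1)\<^sup>2 - a2 / 2) * hv))) (at p)" for p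
    unfolding W5_def vfield.simps case_prod_beta
    by (rule has_derivative_eq_rhs, (rule derivative_intros)+)
      (auto simp: fun_eq_iff algebra_simps power2_eq_square)
qed (auto simp: W5_def algebra_simps power2_eq_square intro!: smooth_intros)

lemma is_symmetry_generator_W6: "is_symmetry_generator a1 a2 (W6 a1 a2)"
proof (rule is_symmetry_generatorI)
  show "smooth (xi (W6 a1 a2))" "smooth (tau (W6 a1 a2))"
    "smooth (eta (W6 a1 a2))" "smooth (phi (W6 a1 a2))"
    unfolding W6_def vfield.simps case_prod_beta by (intro smooth_intros)+
  show "(xi (W6 a1 a2) has_derivative (\<lambda>h. case p of (x, t, u, v) \<Rightarrow> case h of (hx, ht, hu, hv) \<Rightarrow>
      exp (2 * a2 * t) * (a2 * hx + 2 * a2 * (a2 * x + a1) * ht))) (at p)" for p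
    unfolding W6_def vfield.simps case_prod_beta
    by (rule has_derivative_eq_rhs, (rule derivative_intros)+) (auto simp: fun_eq_iff algebra_simps)
  show "(tau (W6 a1 a2) has_derivative (\<lambda>h. case p of (x, t, u, v) \<Rightarrow> case h of (hx, ht, hu, hv) \<Rightarrow>
      exp (2 * a2 * t) * (2 * a2 * ht))) (at p)" for p
    unfolding W6_def vfield.simps case_prod_beta
    by (rule has_derivative_eq_rhs, (rule derivative_intros)+) (auto simp: fun_eq_iff algebra_simps)
  show "(eta (W6 a1 a2) has_derivative (\<lambda>h. case p of (x, t, u, v) \<Rightarrow> case h of (hx, ht, hu, hv) \<Rightarrow>
      exp (2 * a2 * t) * (- 2 * a2\<^sup>2 * u * ht - a2 * hu))) (at p)" for p
    unfolding W6_def vfield.simps case_prod_beta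
    by (rule has_derivative_eq_rhs, (rule derivative_intros)+)
      (auto simp: fun_eq_iff algebra_simps power2_eq_square)
qed (auto simp: W6_def algebra_simps intro!: smooth_intros has_derivative_const)

text \<open>
  Each field has a component that is nonzero at \<open>(0, 0, 1, 0)\<close>; the point is chosen with
  \<open>u = 1\<close> because \<open>W2\<close> vanishes where \<open>u = v = 0\<close>.
\<close>

lemma generators_nonzero:
  assumes "a2 \<noteq> 0" and "W \<in> {W1 a2, W2, W3 a1 a2, W4, W5 a1 a2, W6 a1 a2}"
  shows "W \<noteq> zero_vfield"
proof -
  let ?p = "(0, 0, 1, 0) :: base"
  have "xi W ?p \<noteq> 0 \<or> tau W ?p \<noteq> 0 \<or> eta W ?p \<noteq> 0"
    using assms by (auto simp: W1_def W2_def W3_def W4_def W5_def W6_def)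
  then show ?thesis by (auto simp: zero_vfield_def)
qed

section \<open>The infinite family\<close>

text \<open>
  With \<open>\<xi> = \<tau> = 0\<close> the total derivatives of \<open>\<beta>\<close> and \<open>\<beta>\<^sub>x\<close> are their partial derivatives, so the second
  determining equation is \<open>\<beta>\<^sub>t + (a\<^sub>2 x + a\<^sub>1) \<beta>\<^sub>x - \<beta>\<^sub>x\<^sub>x / 2 = 0\<close>.
\<close>

lemma is_symmetry_generator_W_beta:
  assumes "beta_solution a1 a2 \<beta>"
  shows "is_symmetry_generator a1 a2 (W_beta \<beta>)"
proof -
  define L :: "base \<Rightarrow> real \<times> real" where "L = (\<lambda>p. (fst p, fst (snd p)))"
  have L: "bounded_linear L"
    unfolding L_def by (intro bounded_linear_intros)
  have L_eq: "L (x, t, u, v) = (x, t)" for x t u v by (simp add: L_def)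
  have beta: "smooth \<beta>" and
    eq: "\<And>x t. partial_t \<beta> (x, t) =
        - (a2 * x + a1) * partial_x \<beta> (x, t) + 1/2 * partial_x (partial_x \<beta>) (x, t)"
    using assms by (auto simp: beta_solution_def)
  have beta_x: "smooth (partial_x \<beta>)"
    using smooth_frechet_derivative[OF beta, of "(1, 0)"] by (simp add: partial_x_def[abs_def])
  have W: "xi (W_beta \<beta>) = (\<lambda>_. 0)" "tau (W_beta \<beta>) = (\<lambda>_. 0)"
    "eta (W_beta \<beta>) = (\<lambda>p. partial_x \<beta> (L p))" "phi (W_beta \<beta>) = (\<lambda>p. \<beta> (L p))"
    by (auto simp: W_beta_def L_def)
  note chain = has_derivative_compose[OF bounded_linear_imp_has_derivative[OF L] smooth_has_derivative]
  show ?thesis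
  proof (rule is_symmetry_generatorI[where Dxi = "\<lambda>_ _. 0" and Dtau = "\<lambda>_ _. 0"
        and Deta = "\<lambda>p h. frechet_derivative (partial_x \<beta>) (at (L p)) (L h)"
        and Dphi = "\<lambda>p h. frechet_derivative \<beta> (at (L p)) (L h)"], unfold W)
    fix x t u v ux ut vt :: real and p X T :: base
    assume *: "p = (x, t, u, v)" "X = (1, 0, ux, u)"
    show "frechet_derivative \<beta> (at (L p)) (L X) - u * 0 - vt * 0 - partial_x \<beta> (L p) = 0"
      by (simp add: * L_eq partial_x_def)
    assume T: "T = (0, 1, ut, vt)"
    have LT: "frechet_derivative \<beta> (at (L p)) (L T) = partial_t \<beta> (x, t)"
      and LX: "frechet_derivative (partial_x \<beta>) (at (L p)) (L X) = partial_x (partial_x \<beta>) (x, t)"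
      by (simp_all only: * T L_eq partial_t_def partial_x_def[of "partial_x \<beta>"])
    show "frechet_derivative \<beta> (at (L p)) (L T) - u * 0 - vt * 0 + a2 * 0 * u
        + (a2 * x + a1) * partial_x \<beta> (L p)
        - 1/2 * (frechet_derivative (partial_x \<beta>) (at (L p)) (L X) - ux * 0 - ut * 0) = 0"
      unfolding LT LX unfolding eq *(1) L_eq by (simp add: algebra_simps)
  qed (rule smooth_const smooth_compose_linear[OF L beta] smooth_compose_linear[OF L beta_x]
      has_derivative_const chain[OF beta] chain[OF beta_x])+
qed

lemma beta_solution_const: "beta_solution a1 a2 (\<lambda>_. c)"
proof -
  have "partial_x (\<lambda>_. d) = (\<lambda>_. 0)" "partial_t (\<lambda>_. d) = (\<lambda>_. 0)" for d :: real
    by (simp_all add: partial_x_def[abs_def] partial_t_def[abs_def])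
  then show ?thesis by (simp add: beta_solution_def smooth_const)
qed

lemma infinite_W_beta: "infinite {W_beta \<beta> | \<beta>. beta_solution a1 a2 \<beta>}"
proof -
  have "inj (\<lambda>c::real. W_beta (\<lambda>_. c))"
  proof (rule injI)
    fix c d :: real
    assume "W_beta (\<lambda>_. c) = W_beta (\<lambda>_. d)"
    then have "phi (W_beta (\<lambda>_. c)) (0, 0, 0, 0) = phi (W_beta (\<lambda>_. d)) (0, 0, 0, 0)" by simp
    then show "c = d" by (simp add: W_beta_def)
  qed
  then have "infinite (range (\<lambda>c::real. W_beta (\<lambda>_. c)))"
    by (simp add: finite_image_iff infinite_UNIV_char_0)
  moreover have "range (\<lambda>c::real. W_beta (\<lambda>_. c)) \<subseteq> {W_beta \<beta> | \<beta>. beta_solution a1 a2 \<beta>}"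
    using beta_solution_const by blast
  ultimately show ?thesis by (rule infinite_super[rotated])
qed

theorem proposition3p2:
  fixes a1 a2 :: real
  assumes "a2 \<noteq> 0"
  shows "(\<forall>W \<in> {W1 a2, W2, W3 a1 a2, W4, W5 a1 a2, W6 a1 a2}.
            is_symmetry_generator a1 a2 W \<and> W \<noteq> zero_vfield) \<and>
         (\<forall>\<beta>. beta_solution a1 a2 \<beta> \<longrightarrow> is_symmetry_generator a1 a2 (W_beta \<beta>)) \<and>
         infinite {W_beta \<beta> | \<beta>. beta_solution a1 a2 \<beta>}"
  using generators_nonzero[OF assms] is_symmetry_generator_W1 is_symmetry_generator_W2
    is_symmetry_generator_W3[OF assms] is_symmetry_generator_W4 is_symmetry_generator_W5
    is_symmetry_generator_W6 is_symmetry_generator_W_beta infinite_W_beta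
  by auto

end
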